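(* Let $K=\mathbb{R}$ or $\mathbb{C}$ and let $\mathcal{A}:\mathcal{I}^m\to M_n(K)$ be a gasket with exponent $s_{\mathcal{A}}<\infty$. Then the function $$\xi_{\mathcal{A}}(s)=\lim_{k\to\infty}\Big[\sum_{|I|=k}\|A_I\|^{-s}\Big]^{1/k},\qquad s\ge0,$$ is a well defined log-convex positive strictly decreasing function and satisfies the following properties: 1. $\xi_{\mathcal{A}}(0)=m$; 2. $\xi_{\mathcal{A}}(s)>1$ for $s<s_{\mathcal{A}}$; 3. $\xi_{\mathcal{A}}(s_{\mathcal{A}})=1$; 4. $\xi_{\mathcal{A}}(s)<1$ for $s>s_{\mathcal{A}}$ if $\mathcal{A}$ is a hyperbolic gasket; 5. $\xi_{\mathcal{A}}(s)=1$ for $s>s_{\mathcal{A}}$ if $\mathcal{A}$ is a fast parabolic gasket.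
   Context: $M_n(K)$ carries the max norm $\|M\|=\max_{i,j}|M^i_j|$, and $B^n_r\subset M_n(K)$ is the closed ball of radius $r$ (centred at $0$) in this norm. $\mathcal{I}^m$ is the free monoid of finite words in the letters $1,\dots,m$; $|I|$ is the length of $I$; the empty word is denoted $0$. $\mathcal{J}^m$ is the set of words $i_1i_2\dots i_k$, $k\ge2$, with $i_1\ne i_2=\dots=i_k$, and $\mathcal{J}^m\cdot\mathcal{I}^m=\{JL: J\in\mathcal{J}^m, L\in\mathcal{I}^m\}$. A homomorphism $\mathcal{A}:\mathcal{I}^m\to M_n(K)$ is written $A_I=\mathcal{A}(I)=A_{i_1}\cdots A_{i_k}$ for $I=i_1\dots i_k$ (with $A_0$ the identity matrix). Let $N_{\mathcal{A}}(r)$ be the cardinality of the set $B^n_r\cap\mathcal{A}(\mathcal{I}^m)$; $\mathcal{A}$ is a gasket if $N_{\mathcal{A}}(r)<\infty$ for every $r>0$. Its exponent is $s_{\mathcal{A}}=\sup\{s\ge0:\sum_{I\in\mathcal{I}^m}\|A_I\|^{-s}=\infty\}$. Let $a_k=\min_{|I|=k}\|A_I\|$. The gasket is hyperbolic if there is $\alpha>1$ such that $a_k\asymp\alpha^k$ (the ratio of the two sides is bounded away from $0$ and $\infty$ for all $k$); it is parabolic if $a_k$ grows slower than exponentially. It is fast if there is $c>0$ with $\|A_{IJ}\|\ge c\|A_I\|\|A_J\|$ for all $I\in\mathcal{I}^m$ and $J\in\mathcal{J}^m\cdot\mathcal{I}^m$; "fast parabolic" means both fast and parabolic.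
   Formalization: Strict decrease is claimed on [0,s_A], and on all s≥0 only for non-parabolic gaskets (elsewhere non-increasing), as it contradicts items 3 and 5 for fast parabolic ones; m≥2 is assumed, since for m=1, A_1=[[1,1],[0,1]] violates item 2. *)

theory Defs
  imports "HOL-Analysis.Analysis"
begin

text \<open>
  The field is a type of class \<open>real_normed_field\<close>.  Both \<open>real\<close> and \<open>complex\<close> are instances, and by
  the Gelfand--Mazur theorem they are the only ones up to isomorphism.
\<close>

definition max_norm :: "'k::real_normed_field ^ 'n ^ 'n \<Rightarrow> real" where
  "max_norm M = Max (range (\<lambda>(i, j). norm (M $ i $ j)))"

definition max_ball :: "real \<Rightarrow> ('k::real_normed_field ^ 'n ^ 'n) set" where
  "max_ball r = {M. max_norm M \<le> r}"

definition words :: "nat \<Rightarrow> nat list set" where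
  "words m = lists {1..m}"

definition words_of_length :: "nat \<Rightarrow> nat \<Rightarrow> nat list set" where
  "words_of_length m k = {I \<in> words m. length I = k}"

definition J_words :: "nat \<Rightarrow> nat list set" where
  "J_words m = {i # replicate l j | i j l. i \<in> {1..m} \<and> j \<in> {1..m} \<and> i \<noteq> j \<and> l \<ge> 1}"

definition JI_words :: "nat \<Rightarrow> nat list set" where
  "JI_words m = {J @ L | J L. J \<in> J_words m \<and> L \<in> words m}"

text \<open>Only the values on \<open>words m\<close> are relevant, here and in everything below.\<close>

definition word_hom :: "nat \<Rightarrow> (nat list \<Rightarrow> 'k::real_normed_field ^ 'n ^ 'n) \<Rightarrow> bool" where
  "word_hom m A \<longleftrightarrow>
     A [] = mat 1 \<and> (\<forall>I \<in> words m. \<forall>J \<in> words m. A (I @ J) = A I ** A J)"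

definition gasket :: "nat \<Rightarrow> (nat list \<Rightarrow> 'k::real_normed_field ^ 'n ^ 'n) \<Rightarrow> bool" where
  "gasket m A \<longleftrightarrow> word_hom m A \<and> (\<forall>r>0. finite (max_ball r \<inter> A ` words m))"

text \<open>
  The series is taken in \<open>[0,\<infinity>]\<close>, with \<open>inverse (ennreal (x powr s))\<close> in place of \<open>x powr -s\<close>:
  the two agree for \<open>x > 0\<close>, but the former is \<open>\<infinity>\<close> at \<open>x = 0\<close>, whereas \<open>0 powr -s = 0\<close> in HOL.
  Thus a homomorphism with some \<open>A I = 0\<close> has infinite exponent.
\<close>

definition norm_series :: "nat \<Rightarrow> (nat list \<Rightarrow> 'k::real_normed_field ^ 'n ^ 'n) \<Rightarrow> real \<Rightarrow> ennreal" where
  "norm_series m A s = (\<Sum>\<^sub>\<infinity>I \<in> words m. inverse (ennreal (max_norm (A I) powr s)))"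

definition gasket_exponent :: "nat \<Rightarrow> (nat list \<Rightarrow> 'k::real_normed_field ^ 'n ^ 'n) \<Rightarrow> ereal" where
  "gasket_exponent m A = Sup {ereal s | s. s \<ge> 0 \<and> norm_series m A s = \<infinity>}"

definition min_norm :: "nat \<Rightarrow> (nat list \<Rightarrow> 'k::real_normed_field ^ 'n ^ 'n) \<Rightarrow> nat \<Rightarrow> real" where
  "min_norm m A k = Min ((\<lambda>I. max_norm (A I)) ` words_of_length m k)"

definition hyperbolic :: "nat \<Rightarrow> (nat list \<Rightarrow> 'k::real_normed_field ^ 'n ^ 'n) \<Rightarrow> bool" where
  "hyperbolic m A \<longleftrightarrow>
     (\<exists>\<alpha>>1. \<exists>c>0. \<exists>C. \<forall>k. c * \<alpha> ^ k \<le> min_norm m A k \<and> min_norm m A k \<le> C * \<alpha> ^ k)"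

definition parabolic :: "nat \<Rightarrow> (nat list \<Rightarrow> 'k::real_normed_field ^ 'n ^ 'n) \<Rightarrow> bool" where
  "parabolic m A \<longleftrightarrow> (\<forall>\<beta>>1. (\<lambda>k. min_norm m A k / \<beta> ^ k) \<longlonglongrightarrow> 0)"

definition fast :: "nat \<Rightarrow> (nat list \<Rightarrow> 'k::real_normed_field ^ 'n ^ 'n) \<Rightarrow> bool" where
  "fast m A \<longleftrightarrow>
     (\<exists>c>0. \<forall>I \<in> words m. \<forall>J \<in> JI_words m.
        max_norm (A (I @ J)) \<ge> c * max_norm (A I) * max_norm (A J))"

text \<open>
  Real powers suffice here: a finite exponent (with \<open>m \<ge> 1\<close>) forces \<open>A I \<noteq> 0\<close> for every word \<open>I\<close>.
\<close>

definition xi_seq :: "nat \<Rightarrow> (nat list \<Rightarrow> 'k::real_normed_field ^ 'n ^ 'n) \<Rightarrow> real \<Rightarrow> nat \<Rightarrow> real" where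
  "xi_seq m A s k = root k (\<Sum>I \<in> words_of_length m k. max_norm (A I) powr (- s))"

definition xi :: "nat \<Rightarrow> (nat list \<Rightarrow> 'k::real_normed_field ^ 'n ^ 'n) \<Rightarrow> real \<Rightarrow> real" where
  "xi m A s = lim (xi_seq m A s)"

end

theory Submission
  imports Defs "HOL-Library.Sublist"
begin

text \<open>
  With \<open>c = n\<close>, the weight \<open>u(I) = (c \<parallel>A I\<parallel>)\<^bsup>-s\<^esup>\<close> satisfies \<open>u(IJ) \<ge> u(I) u(J)\<close>, so Fekete's lemma gives
  the limit \<open>\<xi>(s) = exp (L s)\<close> together with \<open>\<Sum>\<^bsub>|I| = k\<^esub> u(I) \<le> \<xi>(s)\<^sup>k\<close>; convexity of \<open>L\<close> is Hoelder's
  inequality, and \<open>\<parallel>A I\<parallel> \<le> D\<^bsup>|I|\<^esup>\<close> makes \<open>L\<close> Lipschitz.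

  The delicate point is \<open>\<xi> > 1\<close> below the exponent. If \<open>\<xi>(s) \<le> 1\<close>, then every finite prefix-free set of
  words has weight at most 1. A finite set of \<open>N\<close> words with norms at most \<open>r\<close> yields a prefix-free set of
  at least \<open>N/2\<close> words with norms at most \<open>D r\<close>, by adding at most one letter to each word. Hence only
  \<open>O(r\<^sup>s)\<close> words have norm at most \<open>r\<close>, and the norm series converges at every \<open>t > s\<close>.
\<close>

subsection \<open>Superadditive sequences\<close>

lemma superadditive_mult:
  fixes x :: "nat \<Rightarrow> real"
  assumes super: "\<And>k l. x k + x l \<le> x (k + l)"
  shows "real q * x j + x r \<le> x (q * j + r)"
proof (induction q)
  case (Suc q)
  have "x j + x (q * j + r) \<le> x (j + (q * j + r))" by (rule super)
  with Suc show ?case by (simp add: algebra_simps)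
qed simp

text \<open>Split \<open>k = q * j + r\<close> with \<open>r < j\<close>. The constant absorbs the
  finitely many values at remainders and the rounding error \<open>r / j * x j\<close>.\<close>

lemma superadditive_lower:
  fixes x :: "nat \<Rightarrow> real"
  assumes super: "\<And>k l. x k + x l \<le> x (k + l)" and "j \<ge> 1"
  obtains C where "C \<ge> 0" "\<And>k. real k * (x j / j) - C \<le> x k"
proof -
  define b where "b = Max ((\<lambda>r. \<bar>x r\<bar>) ` {..<j})"
  have b: "\<bar>x r\<bar> \<le> b" if "r < j" for r
    unfolding b_def using that by (intro Max_ge) auto
  have "0 \<le> b" using b[of 0] \<open>j \<ge> 1\<close> by linarith
  show ?thesis
  proof (rule that)
    show "0 \<le> \<bar>x j\<bar> + b" using \<open>0 \<le> b\<close> by simp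
    fix k
    let ?q = "k div j" and ?r = "k mod j"
    have r: "?r < j" using \<open>j \<ge> 1\<close> by simp
    have "real k = real ?q * real j + real ?r"
      by (metis div_mult_mod_eq of_nat_add of_nat_mult)
    then have "real k * (x j / j) = real ?q * x j + real ?r / j * x j"
      using \<open>j \<ge> 1\<close> by (simp add: field_simps)
    also have "real ?r / j * x j \<le> \<bar>x j\<bar>"
    proof -
      have "real ?r / j * x j \<le> real ?r / j * \<bar>x j\<bar>"
        by (intro mult_left_mono) auto
      also have "\<dots> \<le> 1 * \<bar>x j\<bar>"
        using r by (intro mult_right_mono) auto
      finally show ?thesis by simp
    qed
    finally show "real k * (x j / j) - (\<bar>x j\<bar> + b) \<le> x k"
      using superadditive_mult[of x ?q j ?r, OF super] b[OF r] by (simp add: abs_le_iff)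
  qed
qed

text \<open>Fekete's lemma: the limit is the supremum of \<open>x k / k\<close>, because every
  \<open>k\<close> keeps the slope of a nearly optimal \<open>j\<close> up to a constant.\<close>

lemma superadditive_limit:
  fixes x :: "nat \<Rightarrow> real"
  assumes super: "\<And>k l. x k + x l \<le> x (k + l)"
    and ev_bound: "\<forall>\<^sub>F k in sequentially. x k \<le> B * real k"
  obtains L where "(\<lambda>k. x k / k) \<longlonglongrightarrow> L" "\<And>k. x k \<le> real k * L"
proof
  \<comment> \<open>The eventual bound reaches every \<open>k > 0\<close> through the multiple
    \<open>(N + 1) * k\<close>, which lies beyond \<open>N\<close>.\<close>
  have bound: "x k \<le> B * real k" for k
  proof (cases "k = 0")
    case True
    then show ?thesis using super[of 0 0] by simp
  next
    case False
    obtain N where N: "\<And>n. n \<ge> N \<Longrightarrow> x n \<le> B * real n"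
      using ev_bound by (auto simp: eventually_sequentially)
    have "real N * x k + x k \<le> x (N * k + k)" by (rule superadditive_mult[OF super])
    also have "\<dots> \<le> B * real (N * k + k)" using False by (intro N) (simp add: trans_le_add1)
    finally have "(real N + 1) * x k \<le> (real N + 1) * (B * real k)" by (simp add: algebra_simps)
    then show ?thesis by (subst (asm) mult_le_cancel_left_pos) auto
  qed
  define L where "L = (SUP k\<in>{1..}. x k / real k)"
  have bdd: "bdd_above ((\<lambda>k. x k / real k) ` {1..})"
    using bound by (auto intro!: bdd_aboveI[of _ B] simp: divide_simps)
  have up: "x k / real k \<le> L" if "k \<ge> 1" for k
    unfolding L_def using that bdd by (intro cSUP_upper) auto
  show "x k \<le> real k * L" for k
  proof (cases "k = 0")
    case False
    then show ?thesis using up[of k] by (simp add: field_simps)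
  qed (use bound[of 0] in simp)
  show "(\<lambda>k. x k / k) \<longlonglongrightarrow> L"
  proof (rule order_tendstoI)
    fix a assume "a < L"
    then obtain j where j: "j \<ge> 1" "a < x j / real j"
      unfolding L_def using less_cSUP_iff[OF _ bdd] by auto
    obtain C where C: "\<And>k. real k * (x j / j) - C \<le> x k"
      using superadditive_lower[OF super \<open>j \<ge> 1\<close>] by metis
    have "(\<lambda>k. x j / j - C / real k) \<longlonglongrightarrow> x j / j - 0"
      by (intro tendsto_diff tendsto_const lim_const_over_n)
    with j have "\<forall>\<^sub>F k in sequentially. a < x j / j - C / real k"
      by (intro order_tendstoD(1)) auto
    then show "\<forall>\<^sub>F k in sequentially. a < x k / k"
      using eventually_ge_at_top[of 1]
    proof eventually_elim
      case (elim k)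
      have "x j / j - C / real k = (real k * (x j / j) - C) / real k"
        using elim by (simp add: field_simps)
      also have "\<dots> \<le> x k / k"
        by (intro divide_right_mono C) simp
      finally show ?case using elim by simp
    qed
  next
    fix a assume "L < a"
    then show "\<forall>\<^sub>F k in sequentially. x k / k < a"
      using up by (intro eventually_sequentiallyI[of 1]) (meson le_less_trans)
  qed
qed

subsection \<open>Log-convexity of sums of powers\<close>

lemma sum_powr_log_convex:
  fixes g :: "'a \<Rightarrow> real"
  assumes "finite X" "X \<noteq> {}" "\<And>i. i \<in> X \<Longrightarrow> g i > 0"
  shows "convex_on UNIV (\<lambda>s. ln (\<Sum>i\<in>X. g i powr (- s)))"
proof (rule convex_onI)
  define S where "S s = (\<Sum>i\<in>X. g i powr (- s))" for s
  have S: "S s > 0" for s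
    unfolding S_def using assms by (intro sum_pos) (auto simp: less_imp_neq[symmetric])
  fix t x y :: real assume t: "0 < t" "t < 1"
  \<comment> \<open>Hoelder's inequality: once the terms are normalised to total 1, Young's
    inequality applies to each of them and the right-hand sides add up to 1.\<close>
  have "S ((1 - t) * x + t * y) / (S x powr (1 - t) * S y powr t)
      = (\<Sum>i\<in>X. (g i powr (- x) / S x) powr (1 - t) * (g i powr (- y) / S y) powr t)"
    unfolding S_def[of "(1 - t) * x + t * y"] sum_divide_distrib
  proof (intro sum.cong refl)
    fix i assume "i \<in> X"
    have "g i powr - ((1 - t) * x + t * y) = (g i powr - x) powr (1 - t) * (g i powr - y) powr t"
      by (simp add: powr_powr powr_add[symmetric] algebra_simps)
    then show "g i powr - ((1 - t) * x + t * y) / (S x powr (1 - t) * S y powr t) =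
       (g i powr - x / S x) powr (1 - t) * (g i powr - y / S y) powr t"
      using S[of x] S[of y] by (simp add: powr_divide)
  qed
  also have "\<dots> \<le> (\<Sum>i\<in>X. (1 - t) * (g i powr (- x) / S x) + t * (g i powr (- y) / S y))"
  proof (intro sum_mono Youngs_inequality_0)
    fix i assume "i \<in> X"
    then have "g i > 0" using assms by auto
    then show "0 < g i powr - x / S x" "0 < g i powr - y / S y"
      using S by auto
  qed (use t in auto)
  also have "\<dots> = (1 - t) * (S x / S x) + t * (S y / S y)"
    by (simp add: sum.distrib sum_distrib_left[symmetric] sum_divide_distrib[symmetric] S_def[symmetric])
  also have "\<dots> = 1" using S[of x] S[of y] by simp
  finally have "S ((1 - t) * x + t * y) \<le> S x powr (1 - t) * S y powr t"
    using S[of x] S[of y] by (simp add: divide_simps)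
  then have "ln (S ((1 - t) * x + t * y)) \<le> ln (S x powr (1 - t) * S y powr t)"
    using S S[of "(1 - t) * x + t * y"] by (subst ln_le_cancel_iff) (auto simp: less_imp_neq[symmetric])
  also have "\<dots> = (1 - t) * ln (S x) + t * ln (S y)"
    using S[of x] S[of y] by (simp add: ln_mult ln_powr)
  finally show "ln (\<Sum>i\<in>X. g i powr - ((1 - t) *\<^sub>R x + t *\<^sub>R y))
      \<le> (1 - t) * ln (\<Sum>i\<in>X. g i powr - x) + t * ln (\<Sum>i\<in>X. g i powr - y)"
    unfolding S_def by simp
qed simp

subsection \<open>Summability from a counting bound\<close>

text \<open>List a finite set in increasing order of \<open>g\<close>. The count forces
  \<open>j \<le> K * g x powr s\<close> for the \<open>j\<close>-th element \<open>x\<close>, so its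
  term is at most a constant times \<open>j powr - (t / s)\<close>, and \<open>t / s > 1\<close>.
  The induction removes a maximal element.\<close>

lemma summable_on_of_counting:
  fixes g :: "'a \<Rightarrow> real"
  assumes pos: "\<And>x. x \<in> S \<Longrightarrow> g x > 0" and "0 < s" "s < t" "K > 0"
    and count: "\<And>F r. \<lbrakk>finite F; F \<subseteq> S; F \<noteq> {}; \<And>x. x \<in> F \<Longrightarrow> g x \<le> r\<rbrakk> \<Longrightarrow> real (card F) \<le> K * r powr s"
  shows "(\<lambda>x. g x powr (- t)) summable_on S"
proof -
  \<comment> \<open>Since \<open>0 powr y = 0\<close>, the term at \<open>j = 0\<close> vanishes and
    the sums in effect start at 1.\<close>
  define h where "h = (\<lambda>j::nat. real j powr (- (t / s)))"
  have h: "summable h"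
    unfolding h_def using assms by (subst summable_real_powr_iff) (simp add: field_simps)
  have *: "(\<Sum>x\<in>F. g x powr (- t)) \<le> K powr (t / s) * (\<Sum>j\<le>card F. h j)"
    if "finite F" "F \<subseteq> S" for F
    using that
  proof (induction "card F" arbitrary: F)
    case 0
    then show ?case by (auto simp: h_def)
  next
    case (Suc N)
    then have "F \<noteq> {}" by auto
    define M where "M = Max (g ` F)"
    have M: "M \<in> g ` F" "\<And>y. y \<in> F \<Longrightarrow> g y \<le> M"
      unfolding M_def using Suc.prems \<open>F \<noteq> {}\<close> by auto
    then obtain x where x: "x \<in> F" "\<And>y. y \<in> F \<Longrightarrow> g y \<le> g x" by auto
    have gx: "g x > 0" using x Suc.prems pos by auto
    have card: "real (Suc N) \<le> K * g x powr s"
      using count[of F "g x"] Suc x \<open>F \<noteq> {}\<close> by auto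
    have "g x powr (- t) = (g x powr s) powr (- (t / s))"
      using \<open>0 < s\<close> by (simp add: powr_powr)
    also have "\<dots> \<le> (real (Suc N) / K) powr (- (t / s))"
      using card \<open>K > 0\<close> assms by (intro powr_mono2') (auto simp: field_simps)
    also have "\<dots> = K powr (t / s) * h (Suc N)"
      unfolding h_def using \<open>K > 0\<close> by (simp add: powr_divide powr_minus field_simps)
    finally have 1: "g x powr (- t) \<le> K powr (t / s) * h (Suc N)" .
    have "(\<Sum>y\<in>F - {x}. g y powr (- t)) \<le> K powr (t / s) * (\<Sum>j\<le>card (F - {x}). h j)"
      using Suc x by (intro Suc.hyps) auto
    also have "card (F - {x}) = N" using Suc x by simp
    finally have "(\<Sum>y\<in>F. g y powr (- t)) \<le> K powr (t / s) * (\<Sum>j\<le>N. h j) + K powr (t / s) * h (Suc N)"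
      using 1 x Suc.prems by (simp add: sum.remove[of F x])
    then show ?case
      unfolding Suc.hyps(2)[symmetric] by (simp add: algebra_simps)
  qed
  show ?thesis
  proof (rule nonneg_bdd_above_summable_on)
    show "bdd_above (sum (\<lambda>x. g x powr - t) ` {F. F \<subseteq> S \<and> finite F})"
    proof (rule bdd_aboveI, clarify)
      fix F assume F: "F \<subseteq> S" "finite F"
      have "(\<Sum>j\<le>card F. h j) \<le> suminf h"
        by (intro sum_le_suminf h) (auto simp: h_def)
      then have "K powr (t / s) * (\<Sum>j\<le>card F. h j) \<le> K powr (t / s) * suminf h"
        by (intro mult_left_mono) auto
      with * F show "(\<Sum>x\<in>F. g x powr - t) \<le> K powr (t / s) * suminf h"
        by fastforce
    qed
  qed simp
qed

subsection \<open>Prefix-free sets of words\<close>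

text \<open>These are the prefix codes, the antichains of the tree of words.\<close>

definition prefix_free :: "'a list set \<Rightarrow> bool" where
  "prefix_free P \<longleftrightarrow> (\<forall>p\<in>P. \<forall>q\<in>P. prefix p q \<longrightarrow> p = q)"

text \<open>Two prefixes of one word are comparable, so a word can be decoded in one way
  only.\<close>

lemma prefix_free_append_inj:
  assumes "prefix_free P" "p \<in> P" "q \<in> P" "p @ I = q @ J"
  shows "p = q" "I = J"
proof -
  show "p = q"
    using assms prefix_same_cases[of p "p @ I" q] unfolding prefix_free_def
    by (metis prefixI)
  with assms show "I = J" by simp
qed

lemma words_simps [simp]:
  "[] \<in> words m"
  "i # I \<in> words m \<longleftrightarrow> i \<in> {1..m} \<and> I \<in> words m"
  "I @ J \<in> words m \<longleftrightarrow> I \<in> words m \<and> J \<in> words m"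
  by (auto simp: words_def)

text \<open>In the tree of words, only the branching nodes of \<open>W\<close> are lost: a node of \<open>W\<close> with a single
  branch below it is replaced by one of its children off that branch.\<close>

lemma prefix_free_half:
  assumes "m \<ge> 2" "finite W" "W \<subseteq> words m" "W \<noteq> {}"
  obtains P where "finite P" "prefix_free P" "P \<subseteq> words m" "card W + 1 \<le> 2 * card P"
    "P \<subseteq> W \<union> {I @ [j] | I j. I \<in> W \<and> j \<in> {1..m}}"
proof -
  define good where "good W P \<longleftrightarrow> finite P \<and> prefix_free P \<and> card W + 1 \<le> 2 * card P \<and>
    P \<subseteq> W \<union> {I @ [j] | I j. I \<in> W \<and> j \<in> {1..m}}" for W P :: "nat list set"
  have "\<exists>P. good W P"
    if "\<forall>I\<in>W. length I \<le> N" "finite W" "W \<subseteq> words m" "W \<noteq> {}" for N W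
    using that
  proof (induction N arbitrary: W)
    case 0
    then have "W = {[]}" by auto
    then show ?case by (intro exI[of _ W]) (auto simp: prefix_free_def good_def)
  next
    case (Suc N)
    define B where "B i = {J. i # J \<in> W}" for i
    define X where "X = {i. B i \<noteq> {}}"
    have W: "W = (W \<inter> {[]}) \<union> (\<Union>i\<in>X. (#) i ` B i)"
    proof (intro set_eqI iffI)
      fix I assume "I \<in> W"
      then show "I \<in> (W \<inter> {[]}) \<union> (\<Union>i\<in>X. (#) i ` B i)"
        by (cases I) (auto simp: B_def X_def)
    qed (auto simp: B_def)
    have X: "X \<subseteq> {1..m}" using Suc.prems by (fastforce simp: X_def B_def)
    then have finX: "finite X" by (rule finite_subset) simp
    have finB: "finite (B i)" for i
    proof -
      have "(#) i ` B i \<subseteq> W" by (auto simp: B_def)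
      then show ?thesis using \<open>finite W\<close> by (metis finite_imageD finite_subset inj_on_Cons1)
    qed
    have "\<exists>P. good (B i) P" if "i \<in> X" for i
      using Suc.prems that finB by (intro Suc.IH) (fastforce simp: X_def B_def)+
    then obtain P where "\<And>i. i \<in> X \<Longrightarrow> good (B i) (P i)" by metis
    then have P: "finite (P i)" "prefix_free (P i)" "card (B i) + 1 \<le> 2 * card (P i)"
      "P i \<subseteq> B i \<union> {I @ [j] | I j. I \<in> B i \<and> j \<in> {1..m}}" if "i \<in> X" for i
      using that by (auto simp: good_def)
    define Q where "Q = (\<Union>i\<in>X. (#) i ` P i)"
    have card_union: "card (\<Union>i\<in>X. (#) i ` Y i) = (\<Sum>i\<in>X. card (Y i))"
      if "\<And>i. i \<in> X \<Longrightarrow> finite (Y i)" for Y :: "nat \<Rightarrow> nat list set"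
      using that finX by (subst card_UN_disjoint) (auto simp: card_image)
    have cardQ: "card Q = (\<Sum>i\<in>X. card (P i))"
      unfolding Q_def using P by (intro card_union) auto
    have finQ: "finite Q" unfolding Q_def using finX P by auto
    have freeQ: "prefix_free Q"
      using P unfolding prefix_free_def Q_def by auto
    have subQ: "Q \<subseteq> W \<union> {I @ [j] | I j. I \<in> W \<and> j \<in> {1..m}}"
    proof
      fix J assume "J \<in> Q"
      then obtain i J' where J: "J = i # J'" "J' \<in> P i" "i \<in> X" by (auto simp: Q_def)
      then consider "J' \<in> B i" | I j where "J' = I @ [j]" "I \<in> B i" "j \<in> {1..m}"
        using P(4)[of i] by blast
      then show "J \<in> W \<union> {I @ [j] | I j. I \<in> W \<and> j \<in> {1..m}}"
      proof cases
        case 2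
        then have "J = (i # I) @ [j]" "i # I \<in> W" using J by (auto simp: B_def)
        with 2 show ?thesis by blast
      qed (use J in \<open>auto simp: B_def\<close>)
    qed
    \<comment> \<open>The \<open>+ 1\<close> yields a surplus of one for every nonempty branch. It
      pays for the root word, which \<open>Q\<close> drops, as soon as there are two
      branches.\<close>
    have "(\<Sum>i\<in>X. card (B i) + 1) \<le> (\<Sum>i\<in>X. 2 * card (P i))"
      using P by (intro sum_mono) auto
    then have "(\<Sum>i\<in>X. card (B i)) + card X \<le> 2 * card Q"
      unfolding sum.distrib cardQ sum_distrib_left by simp
    moreover have "card W = card (W \<inter> {[]}) + (\<Sum>i\<in>X. card (B i))"
      using finB finX by (subst W, subst card_Un_disjoint) (auto simp: card_union)
    ultimately have card: "card W + card X \<le> 2 * card Q + card (W \<inter> {[]})"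
      by simp
    consider "X = {}" | "X \<noteq> {}" "card (W \<inter> {[]}) < card X" | "[] \<in> W" "card X = 1"
    proof (cases "X = {}")
      case False
      then have "card X \<noteq> 0" using finX by simp
      moreover have "card (W \<inter> {[]}) = (if [] \<in> W then 1 else 0)" by auto
      ultimately show ?thesis using that False by (cases "[] \<in> W") (auto, linarith)
    qed (use that in auto)
    then show ?case
    proof cases
      case 1
      then have "W \<subseteq> {[]}" using W by blast
      then have "W = {[]}" using Suc.prems by blast
      then show ?thesis by (intro exI[of _ W]) (auto simp: prefix_free_def good_def)
    next
      case 2
      then show ?thesis using card finQ freeQ subQ by (intro exI[of _ Q]) (auto simp: good_def)
    next
      \<comment> \<open>With the root in \<open>W\<close> and a single branch the surplus falls
        short. As \<open>m \<ge> 2\<close>, some other letter is free to stand in for the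
        root.\<close>
      case 3
      then have "card X < card {1..m}" using \<open>m \<ge> 2\<close> by simp
      then obtain j where j: "j \<in> {1..m}" "j \<notin> X"
        using X by (metis less_irrefl subset_antisym subset_iff)
      have new: "[j] \<notin> Q" using j by (auto simp: Q_def)
      have "prefix_free (insert [j] Q)"
        using freeQ j by (auto simp: prefix_free_def Q_def)
      moreover have "[j] \<in> {I @ [j] | I j. I \<in> W \<and> j \<in> {1..m}}"
        using 3 j by force
      ultimately show ?thesis
        using card 3 finQ new subQ by (intro exI[of _ "insert [j] Q"]) (auto simp: good_def)
    qed
  qed
  moreover have "\<forall>I\<in>W. length I \<le> Max (length ` W)" using assms by auto
  ultimately obtain P where P: "good W P" using assms by metis
  moreover have "P \<subseteq> words m" using P assms by (fastforce simp: good_def)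
  ultimately show ?thesis using that by (auto simp: good_def)
qed

subsection \<open>Growth of an almost submultiplicative function on words\<close>

lemma finite_words_of_length [simp]: "finite (words_of_length m k)"
  and card_words_of_length: "card (words_of_length m k) = m ^ k"
proof -
  have "words_of_length m k = {xs. set xs \<subseteq> {1..m} \<and> length xs = k}"
    by (auto simp: words_of_length_def words_def)
  then show "finite (words_of_length m k)" "card (words_of_length m k) = m ^ k"
    by (simp_all add: finite_lists_length_eq card_lists_length_eq)
qed

lemma words_of_length_iff: "I \<in> words_of_length m k \<longleftrightarrow> I \<in> words m \<and> length I = k"
  by (auto simp: words_of_length_def)

text \<open>For matrices, \<open>g\<close> is the max norm of the product, \<open>c\<close> the
  dimension, and \<open>p\<close> an exponent at which the norm series converges. Convergence at
  \<open>p\<close> makes \<open>g\<close> exceed 1 on all but finitely many words.\<close>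

locale submult_words =
  fixes m :: nat and g :: "nat list \<Rightarrow> real" and c p :: real
  assumes m: "m \<ge> 2" and c: "c \<ge> 1"
    and pos: "I \<in> words m \<Longrightarrow> g I > 0"
    and Nil: "g [] = 1"
    and submult: "\<lbrakk>I \<in> words m; J \<in> words m\<rbrakk> \<Longrightarrow> g (I @ J) \<le> c * g I * g J"
    and p: "p \<ge> 0" "(\<lambda>I. g I powr - p) summable_on words m"
begin

section \<open>Sums over words of fixed length and their growth rate\<close>

definition S :: "real \<Rightarrow> nat \<Rightarrow> real" where
  "S s k = (\<Sum>I\<in>words_of_length m k. g I powr - s)"

definition U :: "real \<Rightarrow> nat \<Rightarrow> real" where
  "U s k = (\<Sum>I\<in>words_of_length m k. (c * g I) powr - s)"

text \<open>For a gasket this is \<open>ln \<xi>\<close>, so comparing \<open>\<xi>\<close> with 1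
  means finding the sign of \<open>L\<close>.\<close>

definition L :: "real \<Rightarrow> real" where
  "L s = lim (\<lambda>k. ln (S s k) / k)"

lemma words_of_length_nonempty: "words_of_length m k \<noteq> {}"
  using card_words_of_length[of m k] m by (metis card.empty not_numeral_le_zero power_not_zero)

lemma S_pos: "S s k > 0"
  unfolding S_def using words_of_length_nonempty pos
  by (intro sum_pos) (auto simp: words_of_length_iff dest: pos)

lemma U_eq: "U s k = c powr - s * S s k"
  unfolding U_def S_def sum_distrib_left
proof (intro sum.cong refl)
  fix I assume "I \<in> words_of_length m k"
  then have "g I > 0" using pos by (auto simp: words_of_length_iff)
  then show "(c * g I) powr - s = c powr - s * g I powr - s"
    using c by (simp add: powr_mult)
qed

lemma U_pos: "U s k > 0"
  using S_pos[of s k] c by (simp add: U_eq)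

text \<open>As \<open>c * g\<close> is submultiplicative, its negative powers are
  supermultiplicative; injectivity of concatenation prevents double counting. General sets are
  allowed in order to cover both words of fixed length and prefix-free sets.\<close>

lemma sum_append_le:
  assumes "s \<ge> 0" "finite P" "finite Q" "finite R" "P \<subseteq> words m" "Q \<subseteq> words m" "R \<subseteq> words m"
    and sub: "\<And>I J. \<lbrakk>I \<in> P; J \<in> Q\<rbrakk> \<Longrightarrow> I @ J \<in> R"
    and inj: "inj_on (\<lambda>(I, J). I @ J) (P \<times> Q)"
  shows "(\<Sum>I\<in>P. (c * g I) powr - s) * (\<Sum>I\<in>Q. (c * g I) powr - s) \<le> (\<Sum>I\<in>R. (c * g I) powr - s)"
proof -
  have "(\<Sum>I\<in>P. (c * g I) powr - s) * (\<Sum>I\<in>Q. (c * g I) powr - s)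
      = (\<Sum>(I, J)\<in>P \<times> Q. (c * g I) powr - s * (c * g J) powr - s)"
    by (simp add: sum_product sum.cartesian_product)
  also have "\<dots> \<le> (\<Sum>(I, J)\<in>P \<times> Q. (c * g (I @ J)) powr - s)"
  proof (intro sum_mono, clarify)
    fix I J assume "I \<in> P" "J \<in> Q"
    then have IJ: "I \<in> words m" "J \<in> words m" using assms by auto
    then have gt: "g I > 0" "g J > 0" "g (I @ J) > 0" using pos by auto
    have "(c * g I) powr - s * (c * g J) powr - s = ((c * g I) * (c * g J)) powr - s"
      using gt c by (simp add: powr_mult)
    also have "\<dots> \<le> (c * g (I @ J)) powr - s"
    proof (rule powr_mono2')
      show "c * g (I @ J) \<le> (c * g I) * (c * g J)"
        using submult[OF IJ] c by (simp add: mult_left_mono mult_ac)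
    qed (use gt c \<open>s \<ge> 0\<close> in auto)
    finally show "(c * g I) powr - s * (c * g J) powr - s \<le> (c * g (I @ J)) powr - s" .
  qed
  also have "\<dots> = (\<Sum>I\<in>(\<lambda>(I, J). I @ J) ` (P \<times> Q). (c * g I) powr - s)"
    by (subst sum.reindex[OF inj]) (simp add: case_prod_unfold)
  also have "\<dots> \<le> (\<Sum>I\<in>R. (c * g I) powr - s)"
    using assms by (intro sum_mono2) auto
  finally show ?thesis .
qed

lemma U_supermult:
  assumes "s \<ge> 0"
  shows "U s k * U s l \<le> U s (k + l)"
  unfolding U_def using assms
  by (intro sum_append_le) (auto simp: words_of_length_iff inj_on_def)

text \<open>Each such word contributes at least 1 to the convergent sum at \<open>p\<close>.\<close>

lemma finite_small: "finite {I \<in> words m. g I \<le> 1}"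
proof (rule ccontr)
  let ?E = "{I \<in> words m. g I \<le> 1}"
  assume inf: "infinite ?E"
  have summ: "(\<lambda>I. g I powr - p) summable_on ?E"
    using p(2) by (rule summable_on_subset_banach) auto
  obtain N :: nat where N: "infsum (\<lambda>I. g I powr - p) ?E < real N"
    using reals_Archimedean2 by blast
  obtain F where F: "F \<subseteq> ?E" "finite F" "card F = N"
    using inf infinite_arbitrarily_large by blast
  have "real N = (\<Sum>I\<in>F. 1)" using F by simp
  also have "\<dots> \<le> (\<Sum>I\<in>F. g I powr - p)"
  proof (intro sum_mono)
    fix I assume "I \<in> F"
    then have "0 < g I" "g I \<le> 1" using F pos by auto
    then show "1 \<le> g I powr - p"
      using p(1) powr_mono2'[of "- p" "g I" 1] by simp
  qed
  also have "\<dots> \<le> infsum (\<lambda>I. g I powr - p) ?E"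
    using F summ by (intro finite_sum_le_infsum) auto
  finally show False using N by simp
qed

text \<open>The finitely many exceptional words have bounded length. Beyond it,
  \<open>g I powr - s\<close> is nonincreasing in \<open>s\<close>.\<close>

lemma ge_1_eventually:
  "\<forall>\<^sub>F k in sequentially. \<forall>I\<in>words_of_length m k. g I \<ge> 1"
proof -
  obtain K where K: "\<And>I. I \<in> words m \<Longrightarrow> g I \<le> 1 \<Longrightarrow> length I < K"
    using finite_nat_set_iff_bounded[of "length ` {I \<in> words m. g I \<le> 1}"] finite_small by auto
  show ?thesis
  proof (rule eventually_sequentiallyI, rule ballI)
    fix k I assume "k \<ge> K" "I \<in> words_of_length m k"
    then show "g I \<ge> 1" using K[of I] by (force simp: words_of_length_iff)
  qed
qed

lemma S_antimono_eventually:
  assumes "s \<le> t"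
  shows "\<forall>\<^sub>F k in sequentially. S t k \<le> S s k"
  using ge_1_eventually
proof eventually_elim
  case (elim k)
  then show ?case
    unfolding S_def using assms by (intro sum_mono powr_mono) auto
qed

lemma S_0: "S 0 k = real m ^ k"
proof -
  have "S 0 k = (\<Sum>I\<in>words_of_length m k. 1)"
    unfolding S_def
  proof (intro sum.cong refl)
    fix I assume "I \<in> words_of_length m k"
    then show "g I powr - 0 = 1" using pos[of I] by (auto simp: words_of_length_iff)
  qed
  then show ?thesis by (simp add: card_words_of_length)
qed

text \<open>Fekete's lemma for \<open>ln (U s k)\<close>. The linear bound comes from
  \<open>S s k \<le> S 0 k = m ^ k\<close> for large \<open>k\<close>, and the factor
  \<open>c powr - s\<close> disappears on division by \<open>k\<close>.\<close>

lemma L_lim: "s \<ge> 0 \<Longrightarrow> (\<lambda>k. ln (S s k) / k) \<longlonglongrightarrow> L s"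
  and U_le: "s \<ge> 0 \<Longrightarrow> U s k \<le> exp (real k * L s)"
proof -
  assume s: "s \<ge> 0"
  obtain l where l: "(\<lambda>k. ln (U s k) / k) \<longlonglongrightarrow> l" "\<And>k. ln (U s k) \<le> real k * l"
  proof (rule superadditive_limit)
    show "ln (U s k) + ln (U s l) \<le> ln (U s (k + l))" for k l
      using U_supermult[OF s, of k l] U_pos by (simp add: ln_mult_pos[symmetric])
    show "\<forall>\<^sub>F k in sequentially. ln (U s k) \<le> ln m * real k"
      using S_antimono_eventually[OF s]
    proof eventually_elim
      case (elim k)
      have "U s k \<le> S s k"
        using c s S_pos[of s k] powr_mono[of "-s" 0 c] by (simp add: U_eq mult_le_cancel_right2)
      also note elim
      finally have "U s k \<le> real m ^ k" by (simp add: S_0)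
      then have "ln (U s k) \<le> ln (real m ^ k)" using U_pos m by simp
      then show ?case using m by (simp add: ln_realpow mult.commute)
    qed
  qed blast
  have "(\<lambda>k. ln (U s k) / k + s * ln c / k) \<longlonglongrightarrow> l + 0"
    by (intro tendsto_add l lim_const_over_n)
  moreover have "ln (U s k) / k + s * ln c / k = ln (S s k) / k" for k
    using S_pos[of s k] c by (simp add: U_eq ln_mult ln_powr add_divide_distrib[symmetric])
  ultimately have lim: "(\<lambda>k. ln (S s k) / k) \<longlonglongrightarrow> l" by simp
  then have "L s = l" unfolding L_def by (rule limI)
  with lim show "(\<lambda>k. ln (S s k) / k) \<longlonglongrightarrow> L s" by simp
  show "U s k \<le> exp (real k * L s)"
    using l(2)[of k] U_pos[of s k] \<open>L s = l\<close> by (metis exp_le_cancel_iff exp_ln)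
qed

text \<open>After logarithms and division by \<open>k\<close> the constant \<open>b\<close> drops
  out and the rate \<open>a\<close> survives. Monotonicity, the Lipschitz bound and strict decrease
  of \<open>L\<close> all rest on this.\<close>

lemma L_compare:
  assumes "s \<ge> 0" "t \<ge> 0" "\<forall>\<^sub>F k in sequentially. exp (a * real k - b) * S s k \<le> S t k"
  shows "L s + a \<le> L t"
proof (rule tendsto_le)
  show "(\<lambda>k. ln (S s k) / k + a - b / k) \<longlonglongrightarrow> L s + a"
    using tendsto_diff[OF tendsto_add[OF L_lim[OF assms(1)] tendsto_const[of a]] lim_const_over_n[of b]]
    by simp
  show "\<forall>\<^sub>F k in sequentially. ln (S s k) / k + a - b / k \<le> ln (S t k) / k"
    using assms(3) eventually_gt_at_top[of 0]
  proof eventually_elim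
    case (elim k)
    have "ln (exp (a * real k - b) * S s k) \<le> ln (S t k)"
      using elim S_pos[of s k] S_pos[of t k] by (subst ln_le_cancel_iff) auto
    then have "ln (S s k) + a * real k - b \<le> ln (S t k)"
      using S_pos[of s k] by (simp add: ln_mult)
    then have "(ln (S s k) + a * real k - b) / k \<le> ln (S t k) / k"
      by (rule divide_right_mono) simp
    then show ?case using elim by (simp add: add_divide_distrib diff_divide_distrib)
  qed
qed (use L_lim[OF assms(2)] in auto)

lemma L_antimono:
  assumes "0 \<le> s" "s \<le> t"
  shows "L t \<le> L s"
  using L_compare[of t s 0 0] S_antimono_eventually[OF assms(2)] assms by simp

lemma L_0: "L 0 = ln m"
proof -
  have "\<forall>\<^sub>F k in sequentially. ln (S 0 k) / k = ln m"
    using eventually_gt_at_top[of 0] by eventually_elim (use m in \<open>simp add: S_0 ln_realpow\<close>)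
  then have "(\<lambda>k. ln (S 0 k) / k) \<longlonglongrightarrow> ln m" by (rule tendsto_eventually)
  then show ?thesis using L_lim[of 0] LIMSEQ_unique by blast
qed

text \<open>A pointwise limit of the convex functions \<open>ln (S s k) / k\<close> of
  \<open>s\<close>.\<close>

lemma L_convex: "convex_on {0..} L"
proof (rule convex_onI)
  fix t x y :: real assume *: "0 < t" "t < 1" "x \<in> {0..}" "y \<in> {0..}"
  let ?z = "(1 - t) *\<^sub>R x + t *\<^sub>R y"
  have z: "?z \<ge> 0" using * by simp
  show "L ?z \<le> (1 - t) * L x + t * L y"
  proof (rule LIMSEQ_le)
    show "(\<lambda>k. ln (S ?z k) / k) \<longlonglongrightarrow> L ?z" using z by (rule L_lim)
    show "(\<lambda>k. (1 - t) * (ln (S x k) / k) + t * (ln (S y k) / k)) \<longlonglongrightarrow> (1 - t) * L x + t * L y"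
      using * by (intro tendsto_add tendsto_mult tendsto_const L_lim) auto
    show "\<exists>N. \<forall>k\<ge>N. ln (S ?z k) / k \<le> (1 - t) * (ln (S x k) / k) + t * (ln (S y k) / k)"
    proof (intro exI allI impI)
      fix k :: nat
      have "convex_on UNIV (\<lambda>s. ln (S s k))"
        unfolding S_def using words_of_length_nonempty pos
        by (intro sum_powr_log_convex) (auto simp: words_of_length_iff)
      then have "ln (S ?z k) \<le> (1 - t) * ln (S x k) + t * ln (S y k)"
        using * by (intro convex_onD) auto
      then have "ln (S ?z k) / k \<le> ((1 - t) * ln (S x k) + t * ln (S y k)) / k"
        by (rule divide_right_mono) simp
      then show "ln (S ?z k) / k \<le> (1 - t) * (ln (S x k) / k) + t * (ln (S y k) / k)"
        by (simp add: add_divide_distrib)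
    qed
  qed
qed simp

text \<open>Bounds the growth of \<open>g\<close> caused by one more letter; the inserted 1 ensures
  \<open>ln D \<ge> 0\<close>.\<close>

definition D :: real where
  "D = Max (insert 1 ((\<lambda>i. c * g [i]) ` {1..m}))"

lemma D_ge_1: "D \<ge> 1"
  unfolding D_def by (intro Max_ge) auto

lemma append_letter_le:
  assumes "I \<in> words m" "i \<in> {1..m}"
  shows "g (I @ [i]) \<le> D * g I"
proof -
  have "c * g [i] \<le> D" unfolding D_def using assms by (intro Max_ge) auto
  then have "c * g [i] * g I \<le> D * g I"
    using pos[OF assms(1)] by (intro mult_right_mono) auto
  then show ?thesis using submult[of I "[i]"] assms by (simp add: mult_ac)
qed

lemma le_D_power: "I \<in> words m \<Longrightarrow> g I \<le> D ^ length I"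
proof (induction I rule: rev_induct)
  case (snoc i I)
  then have "g (I @ [i]) \<le> D * g I" by (intro append_letter_le) auto
  also have "\<dots> \<le> D * D ^ length I"
    using snoc D_ge_1 by (intro mult_left_mono) auto
  finally show ?case by simp
qed (simp add: Nil)

text \<open>Words of length \<open>k\<close> have \<open>g I \<le> D ^ k\<close>, so raising the
  exponent by \<open>t\<close> costs each term at most the factor \<open>D ^ k\<close> to the power
  \<open>t\<close>. This is the Lipschitz bound that controls \<open>L\<close> near the
  exponent.\<close>

lemma L_lower:
  assumes "s \<ge> 0" "t \<ge> 0"
  shows "L s - t * ln D \<le> L (s + t)"
proof -
  have "exp (- (t * ln D) * real k - 0) * S s k \<le> S (s + t) k" for k
    unfolding S_def sum_distrib_left
  proof (rule sum_mono)
    fix I assume "I \<in> words_of_length m k"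
    then have I: "g I > 0" "g I \<le> D ^ k"
      using pos le_D_power[of I] by (auto simp: words_of_length_iff)
    have "exp (- (t * ln D) * real k - 0) = (D ^ k) powr - t"
      using D_ge_1 by (simp add: powr_def ln_realpow mult_ac)
    also have "\<dots> \<le> g I powr - t"
      using I assms by (intro powr_mono2') auto
    finally show "exp (- (t * ln D) * real k - 0) * g I powr - s \<le> g I powr - (s + t)"
      using I by (simp add: powr_add mult_ac mult_left_mono powr_diff powr_minus field_simps)
  qed
  then have "L s + - (t * ln D) \<le> L (s + t)"
    using assms by (intro L_compare[where b = 0]) auto
  then show ?thesis by simp
qed

section \<open>The sign of \<open>L\<close> and convergence of the series\<close>

text \<open>All the \<open>S s k\<close> stay below the total sum, so their \<open>k\<close>-th
  roots have limit at most 1.\<close>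

lemma L_nonpos_if_summable:
  assumes "s \<ge> 0" "(\<lambda>I. g I powr - s) summable_on words m"
  shows "L s \<le> 0"
proof -
  define T where "T = infsum (\<lambda>I. g I powr - s) (words m)"
  have S: "S s k \<le> T" for k
    unfolding S_def T_def using assms(2)
    by (intro finite_sum_le_infsum) (auto simp: words_of_length_iff)
  have "(\<lambda>k. ln T / real k) \<longlonglongrightarrow> 0" by (rule lim_const_over_n)
  moreover have "ln (S s k) / real k \<le> ln T / real k" for k
    using S[of k] S_pos[of s k] by (intro divide_right_mono) auto
  ultimately show ?thesis using L_lim[OF assms(1)] by (intro LIMSEQ_le) auto
qed

text \<open>A prefix-free set of words shorter than \<open>N\<close> and of weight \<open>\<theta> > 1\<close> would make the weight of the
  words of length at most \<open>N q\<close> grow like \<open>\<theta> ^ q\<close>, whereas \<open>L s \<le> 0\<close> bounds it linearly in \<open>q\<close>.\<close>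

lemma prefix_free_weight_le_1:
  assumes s: "s \<ge> 0" "L s \<le> 0" and P: "finite P" "prefix_free P" "P \<subseteq> words m"
  shows "(\<Sum>I\<in>P. (c * g I) powr - s) \<le> 1"
proof (rule ccontr)
  let ?u = "\<lambda>I. (c * g I) powr - s"
  define \<theta> where "\<theta> = sum ?u P"
  assume "\<not> sum ?u P \<le> 1"
  then have \<theta>: "\<theta> > 1" by (simp add: \<theta>_def)
  obtain N where N: "\<And>I. I \<in> P \<Longrightarrow> length I < N"
    using finite_nat_set_iff_bounded[of "length ` P"] P(1) by auto
  define B where "B k = (\<Union>j\<le>k. words_of_length m j)" for k
  have B: "B k = {I \<in> words m. length I \<le> k}" for k
    by (auto simp: B_def words_of_length_iff)
  have finB: "finite (B k)" for k by (simp add: B_def)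
  define V where "V k = sum ?u (B k)" for k
  have V_le: "V k \<le> real k + 1" for k
  proof -
    have "V k = (\<Sum>j\<le>k. U s j)"
      unfolding V_def B_def U_def by (rule sum.UNION_disjoint) (auto simp: words_of_length_iff)
    also have "\<dots> \<le> (\<Sum>j\<le>k. 1)"
    proof (rule sum_mono)
      fix j
      have "U s j \<le> exp (real j * L s)" using s by (intro U_le)
      also have "\<dots> \<le> 1" using s by (simp add: mult_nonneg_nonpos)
      finally show "U s j \<le> 1" .
    qed
    finally show ?thesis by simp
  qed
  \<comment> \<open>Members of \<open>P\<close> are put in front of words in \<open>B k\<close>: the
    choice of \<open>N\<close> bounds the lengths, and prefix-freeness makes concatenation
    injective.\<close>
  have step: "\<theta> * V k \<le> V (N + k)" for k
    unfolding \<theta>_def V_def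
  proof (rule sum_append_le)
    show "I @ J \<in> B (N + k)" if "I \<in> P" "J \<in> B k" for I J
      using that N[of I] P by (auto simp: B)
    show "inj_on (\<lambda>(I, J). I @ J) (P \<times> B k)"
    proof (rule inj_onI, clarify)
      fix I J I' J' assume "I \<in> P" "I' \<in> P" "I @ J = I' @ J'"
      then show "I = I' \<and> J = J'" using prefix_free_append_inj[OF P(2)] by blast
    qed
  qed (use s P finB in \<open>auto simp: B\<close>)
  have grow: "\<theta> ^ q * V 0 \<le> V (N * q)" for q
  proof (induction q)
    case (Suc q)
    have "\<theta> ^ Suc q * V 0 \<le> \<theta> * V (N * q)" using Suc \<theta> by simp
    also have "\<dots> \<le> V (N * Suc q)" using step[of "N * q"] by (simp add: add.commute)
    finally show ?case .
  qed simp
  have 1: "V 0 \<le> V (N * q) / \<theta> ^ q" for q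
    using \<theta> grow[of q] by (simp add: pos_le_divide_eq mult.commute)
  have 2: "V (N * q) / \<theta> ^ q \<le> real N * (real q / \<theta> ^ q) + (1 / \<theta>) ^ q" for q
  proof -
    have "V (N * q) / \<theta> ^ q \<le> (real (N * q) + 1) / \<theta> ^ q"
      using V_le[of "N * q"] \<theta> by (intro divide_right_mono) auto
    then show ?thesis by (simp add: add_divide_distrib power_one_over)
  qed
  have "V 0 \<le> real N * (real q / \<theta> ^ q) + (1 / \<theta>) ^ q" for q
    using 1[of q] 2[of q] by linarith
  moreover have "(\<lambda>q. real N * (real q / \<theta> ^ q) + (1 / \<theta>) ^ q) \<longlonglongrightarrow> real N * 0 + 0"
    using \<theta> lim_n_over_pown[of \<theta>]
    by (intro tendsto_add tendsto_mult tendsto_const LIMSEQ_power_zero) auto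
  ultimately have "V 0 \<le> real N * 0 + 0"
    by (intro LIMSEQ_le_const) auto
  \<comment> \<open>Yet \<open>V 0\<close> is the weight \<open>c powr - s > 0\<close> of the empty
    word.\<close>
  moreover have "B 0 = {[]}" by (auto simp: B)
  ultimately show False using c by (simp add: V_def Nil)
qed

text \<open>Pass to a prefix-free set of at least half the size. Its words satisfy
  \<open>g I \<le> D * r\<close>, so each weighs at least \<open>(c * D * r) powr - s\<close>, while
  the total weight is at most 1.\<close>

lemma card_le_of_L_nonpos:
  assumes s: "s \<ge> 0" "L s \<le> 0" and F: "finite F" "F \<subseteq> words m" "F \<noteq> {}" "\<And>I. I \<in> F \<Longrightarrow> g I \<le> r"
  shows "real (card F) \<le> 2 * (c * D) powr s * r powr s"
proof -
  obtain P where P: "finite P" "prefix_free P" "P \<subseteq> words m" "card F + 1 \<le> 2 * card P"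
    "P \<subseteq> F \<union> {I @ [j] | I j. I \<in> F \<and> j \<in> {1..m}}"
    by (rule prefix_free_half[OF m F(1,2,3)])
  have "r > 0" using F pos by (meson all_not_in_conv less_le_trans subsetD)
  have le: "g I \<le> D * r" if I: "I \<in> P" for I
  proof -
    consider "I \<in> F" | J j where "I = J @ [j]" "J \<in> F" "j \<in> {1..m}" using subsetD[OF P(5) I] by blast
    then show ?thesis
    proof cases
      case 1
      then have "1 * g I \<le> D * r" using F D_ge_1 pos by (intro mult_mono) (auto intro: less_imp_le)
      then show ?thesis by simp
    next
      case 2
      then have "g I \<le> D * g J" using append_letter_le F by auto
      also have "\<dots> \<le> D * r" using 2 F D_ge_1 by (intro mult_left_mono) auto
      finally show ?thesis .
    qed
  qed
  have "real (card P) * (c * (D * r)) powr - s = (\<Sum>I\<in>P. (c * (D * r)) powr - s)" by simp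
  also have "\<dots> \<le> (\<Sum>I\<in>P. (c * g I) powr - s)"
    using le c s pos P(3) by (intro sum_mono powr_mono2') (auto intro!: mult_pos_pos)
  also have "\<dots> \<le> 1" by (rule prefix_free_weight_le_1[OF s P(1-3)])
  finally have "real (card P) \<le> (c * (D * r)) powr s"
    using c D_ge_1 \<open>r > 0\<close> by (simp add: powr_minus field_simps)
  also have "\<dots> = (c * D) powr s * r powr s"
    using c D_ge_1 \<open>r > 0\<close> by (simp add: powr_mult)
  finally show ?thesis using P(4) by linarith
qed

text \<open>A converse to \<open>L_nonpos_if_summable\<close> with a loss in the exponent: the count
  \<open>O(r powr s)\<close> gives convergence at every larger exponent.\<close>

lemma summable_if_L_nonpos:
  assumes "s \<ge> 0" "L s \<le> 0" "s < t"
  shows "(\<lambda>I. g I powr - t) summable_on words m"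
proof (rule summable_on_of_counting)
  \<comment> \<open>\<open>L 0 = ln m > 0\<close> excludes \<open>s = 0\<close>.\<close>
  have "s \<noteq> 0" using assms(2) m by (auto simp: L_0)
  then show "0 < s" using assms by simp
  show "0 < 2 * (c * D) powr s" using c D_ge_1 by simp
qed (use pos card_le_of_L_nonpos[OF assms(1,2)] assms in auto)

section \<open>The smallest value on words of fixed length\<close>

definition a :: "nat \<Rightarrow> real" where
  "a k = Min (g ` words_of_length m k)"

lemma a_le: "I \<in> words_of_length m k \<Longrightarrow> a k \<le> g I"
  unfolding a_def by (intro Min_le) auto

lemma a_attained: obtains I where "I \<in> words_of_length m k" "a k = g I"
proof -
  have "a k \<in> g ` words_of_length m k"
    unfolding a_def using words_of_length_nonempty by (intro Min_in) auto
  then show ?thesis using that by auto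
qed

lemma a_pos: "a k > 0"
  by (rule a_attained[of k]) (use pos in \<open>auto simp: words_of_length_iff\<close>)

lemma a_submult: "a (k + l) \<le> c * a k * a l"
proof -
  obtain I where I: "I \<in> words_of_length m k" "a k = g I" by (rule a_attained)
  obtain J where J: "J \<in> words_of_length m l" "a l = g J" by (rule a_attained)
  have "a (k + l) \<le> g (I @ J)" using I J by (intro a_le) (auto simp: words_of_length_iff)
  also have "\<dots> \<le> c * a k * a l" using submult[of I J] I J by (auto simp: words_of_length_iff)
  finally show ?thesis .
qed

text \<open>By submultiplicativity of \<open>c * a\<close>, a single length \<open>j\<close> with
  \<open>c * a j < \<beta> ^ j\<close> would make \<open>a k / \<beta> ^ k\<close> decay
  geometrically. Thus failure of convergence to 0 already gives an exponential lower bound at every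
  length.\<close>

lemma a_exponential:
  assumes "\<beta> > 1" "\<not> (\<lambda>k. a k / \<beta> ^ k) \<longlonglongrightarrow> 0" "j \<ge> 1"
  shows "\<beta> ^ j \<le> c * a j"
proof (rule ccontr)
  define x where "x k = - ln (c * a k)" for k
  have ca: "c * a k > 0" for k using c a_pos by simp
  assume "\<not> \<beta> ^ j \<le> c * a j"
  then have "ln (c * a j) < ln (\<beta> ^ j)" using ca assms by simp
  \<comment> \<open>The left side is the logarithm of the ratio of the geometric decay.\<close>
  then have slope: "- (x j / j) - ln \<beta> < 0"
    using assms by (simp add: x_def ln_realpow field_simps)
  have "x k + x l \<le> x (k + l)" for k l
  proof -
    have "c * a (k + l) \<le> (c * a k) * (c * a l)"
      using mult_left_mono[OF a_submult[of k l], of c] c by (simp add: mult_ac)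
    then have "ln (c * a (k + l)) \<le> ln ((c * a k) * (c * a l))"
      using ca[of "k + l"] ca[of k] ca[of l] by (subst ln_le_cancel_iff) (auto simp: zero_less_mult_iff)
    then show ?thesis using ca[of k] ca[of l] by (simp add: x_def ln_mult_pos)
  qed
  then obtain C where C: "\<And>k. real k * (x j / j) - C \<le> x k"
    using superadditive_lower[of x j] \<open>j \<ge> 1\<close> by metis
  have le: "a k / \<beta> ^ k \<le> exp C * exp (- (x j / j) - ln \<beta>) ^ k" for k
  proof -
    have "a k \<le> c * a k" using c a_pos[of k] by simp
    also have "\<dots> = exp (- x k)" using ca[of k] by (simp add: x_def)
    also have "\<dots> \<le> exp (C - real k * (x j / j))" using C[of k] by simp
    finally have "a k / \<beta> ^ k \<le> exp (C - real k * (x j / j)) / exp (real k * ln \<beta>)"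
      using assms by (simp add: exp_of_nat_mult divide_right_mono)
    also have "\<dots> = exp (C + real k * (- (x j / j) - ln \<beta>))"
      unfolding exp_diff[symmetric] by (simp add: algebra_simps)
    also have "\<dots> = exp C * exp (- (x j / j) - ln \<beta>) ^ k"
      unfolding exp_add exp_of_nat_mult ..
    finally show ?thesis .
  qed
  have "(\<lambda>k. exp C * exp (- (x j / j) - ln \<beta>) ^ k) \<longlonglongrightarrow> exp C * 0"
    using slope by (intro tendsto_mult tendsto_const LIMSEQ_power_zero) simp
  then have "(\<lambda>k. exp C * exp (- (x j / j) - ln \<beta>) ^ k) \<longlonglongrightarrow> 0" by simp
  then have "(\<lambda>k. a k / \<beta> ^ k) \<longlonglongrightarrow> 0"
    by (rule tendsto_sandwich[OF _ _ tendsto_const, rotated 2])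
      (use le a_pos assms in \<open>auto simp: less_imp_le\<close>)
  with assms(2) show False by simp
qed

text \<open>All words of length \<open>k \<ge> 1\<close> have
  \<open>g I \<ge> \<beta> ^ k / c\<close>, so lowering the exponent from \<open>t\<close> to
  \<open>s\<close> gains an exponential factor uniformly in \<open>I\<close>.\<close>

lemma L_strict:
  assumes "\<beta> > 1" "\<not> (\<lambda>k. a k / \<beta> ^ k) \<longlonglongrightarrow> 0" "0 \<le> s" "s < t"
  shows "L t < L s"
proof -
  have "exp ((t - s) * ln \<beta> * real k - (t - s) * ln c) * S t k \<le> S s k" if "k \<ge> 1" for k
    unfolding S_def sum_distrib_left
  proof (rule sum_mono)
    fix I assume I: "I \<in> words_of_length m k"
    then have gI: "g I > 0" using pos by (auto simp: words_of_length_iff)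
    have "\<beta> ^ k \<le> c * g I"
      using a_exponential[OF assms(1,2) that] mult_left_mono[OF a_le[OF I], of c] c by linarith
    then have "\<beta> ^ k / c \<le> g I" using c by (simp add: field_simps)
    then have "(\<beta> ^ k / c) powr (t - s) \<le> g I powr (t - s)"
      using assms c by (intro powr_mono2) auto
    also have "(\<beta> ^ k / c) powr (t - s) = exp ((t - s) * ln \<beta> * real k - (t - s) * ln c)"
      using assms c by (simp add: powr_def ln_div ln_realpow algebra_simps)
    finally have "exp ((t - s) * ln \<beta> * real k - (t - s) * ln c) * g I powr - t
        \<le> g I powr (t - s) * g I powr - t"
      by (intro mult_right_mono) auto
    also have "\<dots> = g I powr - s" by (simp add: powr_add[symmetric])
    finally show "exp ((t - s) * ln \<beta> * real k - (t - s) * ln c) * g I powr - t \<le> g I powr - s" .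
  qed
  then have "L t + (t - s) * ln \<beta> \<le> L s"
    using assms by (intro L_compare[where b = "(t - s) * ln c"] eventually_sequentiallyI[of 1]) auto
  moreover have "(t - s) * ln \<beta> > 0" using assms by simp
  ultimately show ?thesis by simp
qed

text \<open>One minimising word of subexponential size already keeps \<open>S s k\<close> from
  decaying exponentially.\<close>

lemma L_nonneg:
  assumes "s \<ge> 0" "\<And>\<beta>. \<beta> > 1 \<Longrightarrow> (\<lambda>k. a k / \<beta> ^ k) \<longlonglongrightarrow> 0"
  shows "L s \<ge> 0"
proof (rule ccontr)
  assume "\<not> L s \<ge> 0"
  \<comment> \<open>Chosen so that \<open>- (s * e)\<close> exceeds \<open>L s\<close> by exactly
    \<open>e\<close>.\<close>
  define e where "e = - L s / (s + 1)"
  have "e > 0" using \<open>\<not> L s \<ge> 0\<close> assms by (simp add: e_def divide_neg_pos)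
  then have "\<forall>\<^sub>F k in sequentially. a k / exp e ^ k < 1"
    using assms(2)[of "exp e"] by (intro order_tendstoD) auto
  then have "\<forall>\<^sub>F k in sequentially. - (s * e) \<le> ln (S s k) / k"
    using eventually_gt_at_top[of 0]
  proof eventually_elim
    case (elim k)
    obtain I where I: "I \<in> words_of_length m k" "a k = g I" by (rule a_attained)
    have "exp (- (s * e) * real k) = exp (e * real k) powr - s"
      by (simp add: powr_def mult_ac)
    also have "\<dots> \<le> g I powr - s"
      using elim I a_pos[of k] assms
      by (intro powr_mono2') (auto simp: exp_of_nat2_mult)
    also have "\<dots> \<le> S s k"
      unfolding S_def using I by (intro member_le_sum) auto
    finally have "- (s * e) * real k \<le> ln (S s k)" using S_pos by (simp add: ln_ge_iff)
    then show ?case using elim by (simp add: field_simps)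
  qed
  then have "- (s * e) \<le> L s"
    using L_lim[OF assms(1)] by (intro tendsto_lowerbound) auto
  moreover have "e * (s + 1) = - L s" using assms by (simp add: e_def)
  then have "L s = - (s * e) - e" by (simp add: algebra_simps)
  ultimately show False using \<open>e > 0\<close> by simp
qed

end

subsection \<open>The max norm and the norm series\<close>

lemma norm_le_max_norm: "norm (M $ i $ j) \<le> max_norm M"
  unfolding max_norm_def by (rule Max_ge) (auto intro!: image_eqI[of _ _ "(i, j)"])

lemma max_norm_leI: "(\<And>i j. norm (M $ i $ j) \<le> r) \<Longrightarrow> max_norm M \<le> r"
  unfolding max_norm_def by (subst Max_le_iff) auto

lemma max_norm_nonneg [simp]: "0 \<le> max_norm M"
  using norm_le_max_norm norm_ge_zero order_trans by blast

lemma max_norm_mat_1: "max_norm (mat 1 :: 'k::real_normed_field ^ 'n ^ 'n) = 1"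
proof (rule antisym)
  show "max_norm (mat 1 :: 'k ^ 'n ^ 'n) \<le> 1"
    by (rule max_norm_leI) (simp add: mat_def)
  show "1 \<le> max_norm (mat 1 :: 'k ^ 'n ^ 'n)"
    using norm_le_max_norm[of "mat 1 :: 'k ^ 'n ^ 'n" undefined undefined] by (simp add: mat_def)
qed

text \<open>An entry of the product is a sum of \<open>CARD('n)\<close> products; this number
  becomes the constant \<open>c\<close>.\<close>

lemma max_norm_mult:
  fixes M N :: "'k::real_normed_field ^ 'n ^ 'n"
  shows "max_norm (M ** N) \<le> real CARD('n) * max_norm M * max_norm N"
proof (rule max_norm_leI)
  fix i j
  have "norm ((M ** N) $ i $ j) \<le> (\<Sum>k\<in>UNIV. norm (M $ i $ k * N $ k $ j))"
    by (simp add: matrix_matrix_mult_def norm_sum)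
  also have "\<dots> \<le> (\<Sum>k\<in>(UNIV :: 'n set). max_norm M * max_norm N)"
    by (intro sum_mono) (auto simp: norm_mult intro!: mult_mono norm_le_max_norm)
  finally show "norm ((M ** N) $ i $ j) \<le> real CARD('n) * max_norm M * max_norm N"
    by (simp add: mult_ac)
qed

lemma sum_inverse_ennreal_powr:
  assumes "\<And>x. x \<in> F \<Longrightarrow> f x > 0"
  shows "(\<Sum>x\<in>F. inverse (ennreal (f x powr s))) = ennreal (\<Sum>x\<in>F. f x powr - s)"
proof -
  have "(\<Sum>x\<in>F. inverse (ennreal (f x powr s))) = (\<Sum>x\<in>F. ennreal (f x powr - s))"
    using assms by (intro sum.cong refl) (simp add: inverse_ennreal powr_minus less_imp_neq[symmetric])
  then show ?thesis by simp
qed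

text \<open>At norm 0 the \<open>ennreal\<close> term is \<open>\<infinity>\<close> but the
  \<open>powr\<close> term is 0, hence the separate positivity clause. For positive norms the two
  series have the same finite partial sums.\<close>

lemma norm_series_finite_iff:
  "norm_series m A s \<noteq> \<infinity> \<longleftrightarrow>
    (\<forall>I\<in>words m. max_norm (A I) > 0) \<and> (\<lambda>I. max_norm (A I) powr - s) summable_on words m"
proof (intro iffI conjI)
  let ?f = "\<lambda>I. inverse (ennreal (max_norm (A I) powr s))"
  assume fin: "norm_series m A s \<noteq> \<infinity>"
  have le: "sum ?f F \<le> norm_series m A s" if "finite F" "F \<subseteq> words m" for F
  proof -
    have "sum ?f F = infsum ?f F" using that by simp
    also have "\<dots> \<le> infsum ?f (words m)"
      using that by (intro infsum_mono_neutral nonneg_summable_on_complete) auto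
    finally show ?thesis by (simp add: norm_series_def)
  qed
  show *: "\<forall>I\<in>words m. max_norm (A I) > 0"
  proof (rule ballI, rule ccontr)
    fix I assume I: "I \<in> words m" "\<not> max_norm (A I) > 0"
    then have "max_norm (A I) = 0" using max_norm_nonneg[of "A I"] by linarith
    with le[of "{I}"] I fin show False by (simp add: top_unique)
  qed
  show "(\<lambda>I. max_norm (A I) powr - s) summable_on words m"
  proof (rule nonneg_bdd_above_summable_on)
    show "bdd_above (sum (\<lambda>I. max_norm (A I) powr - s) ` {F. F \<subseteq> words m \<and> finite F})"
    proof (rule bdd_aboveI, clarify)
      fix F assume F: "F \<subseteq> words m" "finite F"
      have "ennreal (\<Sum>I\<in>F. max_norm (A I) powr - s) = sum ?f F"
        using F * by (intro sum_inverse_ennreal_powr[symmetric]) blast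
      also have "\<dots> \<le> norm_series m A s" using F by (intro le)
      also have "\<dots> = ennreal (enn2real (norm_series m A s))"
        using fin by (simp add: less_top)
      finally show "(\<Sum>I\<in>F. max_norm (A I) powr - s) \<le> enn2real (norm_series m A s)"
        by (simp add: ennreal_le_iff)
    qed
  qed simp
next
  assume "(\<forall>I\<in>words m. max_norm (A I) > 0) \<and> (\<lambda>I. max_norm (A I) powr - s) summable_on words m"
  then have *: "\<And>I. I \<in> words m \<Longrightarrow> max_norm (A I) > 0"
    and summ: "(\<lambda>I. max_norm (A I) powr - s) summable_on words m" by auto
  have "norm_series m A s \<le> ennreal (\<Sum>\<^sub>\<infinity>I\<in>words m. max_norm (A I) powr - s)"
    unfolding norm_series_def
  proof (rule infsum_le_finite_sums)
    fix F assume F: "finite F" "F \<subseteq> words m"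
    have "(\<Sum>I\<in>F. inverse (ennreal (max_norm (A I) powr s))) = ennreal (\<Sum>I\<in>F. max_norm (A I) powr - s)"
      using F * by (intro sum_inverse_ennreal_powr) blast
    also have "\<dots> \<le> ennreal (\<Sum>\<^sub>\<infinity>I\<in>words m. max_norm (A I) powr - s)"
      using F summ by (intro ennreal_leI finite_sum_le_infsum) auto
    finally show "(\<Sum>I\<in>F. inverse (ennreal (max_norm (A I) powr s))) \<le> \<dots>" .
  qed (auto intro: nonneg_summable_on_complete)
  then show "norm_series m A s \<noteq> \<infinity>" by (auto simp: top_unique)
qed

section \<open>Properties of \<open>xi\<close> for a gasket of finite exponent\<close>

text \<open>Since \<open>\<xi>\<close> is constant beyond the exponent in the fast parabolic case,
  strict decrease is claimed up to \<open>s\<^sub>A\<close> in general and on the whole half-line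
  for gaskets that are not parabolic. For \<open>m = 1\<close>, a nontrivial unipotent 2 by 2 matrix
  has exponent 1 and \<open>\<xi>\<close> identically 1, whence \<open>m \<ge> 2\<close>.\<close>

theorem theorem2:
  fixes A :: "nat list \<Rightarrow> 'k::real_normed_field ^ 'n ^ 'n"
    and m :: nat and s\<^sub>A :: real
  assumes "m \<ge> 2"
    and "gasket m A"
    and "gasket_exponent m A = ereal s\<^sub>A"
  shows "(\<forall>s\<ge>0. convergent (xi_seq m A s))
    \<and> (\<forall>s\<ge>0. xi m A s > 0)
    \<and> convex_on {0..} (\<lambda>s. ln (xi m A s))
    \<and> antimono_on {0..} (xi m A)
    \<and> strict_antimono_on {0..s\<^sub>A} (xi m A)
    \<and> (\<not> parabolic m A \<longrightarrow> strict_antimono_on {0..} (xi m A))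
    \<and> xi m A 0 = real m
    \<and> (\<forall>s\<ge>0. s < s\<^sub>A \<longrightarrow> xi m A s > 1)
    \<and> xi m A s\<^sub>A = 1
    \<and> (hyperbolic m A \<longrightarrow> (\<forall>s>s\<^sub>A. xi m A s < 1))
    \<and> (fast m A \<and> parabolic m A \<longrightarrow> (\<forall>s>s\<^sub>A. xi m A s = 1))"
proof -
  define E where "E = {ereal s | s. s \<ge> 0 \<and> norm_series m A s = \<infinity>}"
  have Sup: "Sup E = ereal s\<^sub>A" using assms(3) by (simp add: gasket_exponent_def E_def)
  have "s\<^sub>A \<ge> 0"
  proof -
    \<comment> \<open>The supremum of the empty set in \<open>ereal\<close> is
      \<open>-\<infinity>\<close>, so a real supremum forces a member, and members are
      nonnegative.\<close>
    have "E \<noteq> {}" using Sup by (auto simp: bot_ereal_def)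
    then obtain s where "s \<ge> 0" "ereal s \<in> E" by (auto simp: E_def)
    then have "ereal s \<le> ereal s\<^sub>A" using Sup_upper[of "ereal s" E] by (simp add: Sup)
    with \<open>s \<ge> 0\<close> show ?thesis by simp
  qed
  have finite_above: "norm_series m A s \<noteq> \<infinity>" if "s > s\<^sub>A" for s
  proof
    assume "norm_series m A s = \<infinity>"
    then have "ereal s \<in> E" using that \<open>s\<^sub>A \<ge> 0\<close> by (auto simp: E_def)
    then have "ereal s \<le> ereal s\<^sub>A" using Sup_upper[of "ereal s" E] by (simp add: Sup)
    with that show False by simp
  qed
  define g where "g I = max_norm (A I)" for I
  have hom: "A [] = mat 1" "\<And>I J. \<lbrakk>I \<in> words m; J \<in> words m\<rbrakk> \<Longrightarrow> A (I @ J) = A I ** A J"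
    using assms(2) by (auto simp: gasket_def word_hom_def)
  \<comment> \<open>The series converges beyond \<open>s\<^sub>A\<close>, in particular at
    \<open>s\<^sub>A + 1\<close>; its finiteness there also makes all norms positive.\<close>
  interpret submult_words m g "real CARD('n)" "s\<^sub>A + 1"
  proof
    show "1 \<le> real CARD('n)" by (simp add: Suc_leI)
    show "g [] = 1" by (simp add: g_def hom max_norm_mat_1)
    show "g (I @ J) \<le> real CARD('n) * g I * g J" if "I \<in> words m" "J \<in> words m" for I J
      using that by (simp add: g_def hom max_norm_mult)
    show "g I > 0" if "I \<in> words m" for I
      using finite_above[of "s\<^sub>A + 1"] that unfolding norm_series_finite_iff g_def by simp
    show "(\<lambda>I. g I powr - (s\<^sub>A + 1)) summable_on words m"
      using finite_above[of "s\<^sub>A + 1"] unfolding norm_series_finite_iff g_def by simp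
  qed (use assms(1) \<open>s\<^sub>A \<ge> 0\<close> in auto)
  have min_norm: "min_norm m A = a" by (auto simp: min_norm_def a_def g_def)
  have xi_lim: "xi_seq m A s \<longlonglongrightarrow> exp (L s)" if "s \<ge> 0" for s
  proof (rule Lim_transform_eventually)
    show "(\<lambda>k. exp (ln (S s k) / k)) \<longlonglongrightarrow> exp (L s)"
      using L_lim[OF that] by (rule tendsto_exp)
    \<comment> \<open>At \<open>k = 0\<close> the sides differ: \<open>root 0\<close> gives 0,
      whereas division by 0 gives \<open>exp 0 = 1\<close>.\<close>
    show "\<forall>\<^sub>F k in sequentially. exp (ln (S s k) / k) = xi_seq m A s k"
      using eventually_gt_at_top[of 0]
    proof eventually_elim
      case (elim k)
      have "xi_seq m A s k = root k (S s k)" by (simp add: xi_seq_def S_def g_def)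
      also have "\<dots> = exp (ln (S s k) / k)"
        using elim S_pos[of s k] by (simp add: root_powr_inverse powr_def)
      finally show ?case ..
    qed
  qed
  have xi: "xi m A s = exp (L s)" if "s \<ge> 0" for s
    unfolding xi_def using xi_lim[OF that] by (rule limI)
  have L_above: "L s \<le> 0" if "s > s\<^sub>A" for s
    using finite_above[OF that] that \<open>s\<^sub>A \<ge> 0\<close> unfolding norm_series_finite_iff
    by (intro L_nonpos_if_summable) (auto simp: g_def)
  \<comment> \<open>Some \<open>t > s\<close> has a divergent series, whereas
    \<open>L s \<le> 0\<close> would give convergence at every exponent above
    \<open>s\<close>.\<close>
  have L_below: "L s > 0" if "s \<ge> 0" "s < s\<^sub>A" for s
  proof (rule ccontr)
    assume "\<not> L s > 0"
    have "ereal s < Sup E" using that by (simp add: Sup)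
    then obtain t where t: "s < t" "norm_series m A t = \<infinity>"
      by (auto simp: less_Sup_iff E_def)
    have "(\<lambda>I. g I powr - t) summable_on words m"
      using \<open>\<not> L s > 0\<close> that t by (intro summable_if_L_nonpos[of s]) auto
    then have "norm_series m A t \<noteq> \<infinity>"
      unfolding norm_series_finite_iff using pos by (simp add: g_def)
    with t show False by simp
  qed
  have lnD: "ln D \<ge> 0" using D_ge_1 by simp
  \<comment> \<open>If \<open>L\<close> were positive at \<open>s\<^sub>A\<close>, the Lipschitz
    bound would leave at least \<open>e > 0\<close> at \<open>s\<^sub>A + e\<close>, where
    \<open>L\<close> is nonpositive. The \<open>+ 1\<close> in \<open>e\<close> provides this margin
    and a positive denominator.\<close>
  have L_le: "L s\<^sub>A \<le> 0"
  proof (rule ccontr)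
    assume "\<not> L s\<^sub>A \<le> 0"
    define e where "e = L s\<^sub>A / (ln D + 1)"
    have "e > 0" "e * (ln D + 1) = L s\<^sub>A"
      using \<open>\<not> L s\<^sub>A \<le> 0\<close> lnD by (auto simp: e_def)
    then have "e * ln D + e = L s\<^sub>A" by (simp add: algebra_simps)
    moreover have "L s\<^sub>A - e * ln D \<le> L (s\<^sub>A + e)"
      using \<open>e > 0\<close> \<open>s\<^sub>A \<ge> 0\<close> by (intro L_lower) auto
    moreover have "L (s\<^sub>A + e) \<le> 0" using \<open>e > 0\<close> by (intro L_above) simp
    ultimately show False using \<open>e > 0\<close> by linarith
  qed
  have "L 0 > 0" using assms(1) by (simp add: L_0)
  with L_le have "s\<^sub>A > 0" using \<open>s\<^sub>A \<ge> 0\<close> by (cases "s\<^sub>A = 0") auto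
  \<comment> \<open>The mirror image, with a step to the left; the minimum with
    \<open>s\<^sub>A\<close> keeps \<open>s\<^sub>A - e\<close> nonnegative.\<close>
  have L_eq: "L s\<^sub>A = 0"
  proof (rule ccontr)
    assume "L s\<^sub>A \<noteq> 0"
    define e where "e = min s\<^sub>A (- L s\<^sub>A / (ln D + 1))"
    have "- L s\<^sub>A / (ln D + 1) > 0" using L_le \<open>L s\<^sub>A \<noteq> 0\<close> lnD by (intro divide_pos_pos) auto
    then have e: "e > 0" "e \<le> s\<^sub>A" using \<open>s\<^sub>A > 0\<close> by (auto simp: e_def)
    have "e \<le> - L s\<^sub>A / (ln D + 1)" by (simp add: e_def)
    then have "e * (ln D + 1) \<le> - L s\<^sub>A" using lnD by (subst (asm) pos_le_divide_eq) auto
    then have "e * ln D + e \<le> - L s\<^sub>A" by (simp add: algebra_simps)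
    moreover have "L (s\<^sub>A - e) - e * ln D \<le> L s\<^sub>A"
      using L_lower[of "s\<^sub>A - e" e] e by simp
    moreover have "L (s\<^sub>A - e) > 0" using e by (intro L_below) auto
    ultimately show False using e by linarith
  qed
  \<comment> \<open>Here \<open>y\<close> lies on the segment from \<open>x\<close> to
    \<open>s\<^sub>A\<close>; convexity together with \<open>L s\<^sub>A = 0\<close> and
    \<open>L x > 0\<close> forces a strict drop.\<close>
  have strict: "L y < L x" if "0 \<le> x" "x < y" "y \<le> s\<^sub>A" for x y
  proof -
    define t where "t = (y - x) / (s\<^sub>A - x)"
    have t: "0 < t" "t \<le> 1" using that by (auto simp: t_def)
    have "y = x + t * (s\<^sub>A - x)" using that by (simp add: t_def)
    then have "y = (1 - t) *\<^sub>R x + t *\<^sub>R s\<^sub>A" by (simp add: algebra_simps)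
    then have "L y \<le> (1 - t) * L x + t * L s\<^sub>A"
      using convex_onD[OF L_convex, of t x "s\<^sub>A"] t that by auto
    also have "\<dots> < L x" using L_below[of x] that t by (simp add: L_eq)
    finally show ?thesis .
  qed
  have strict_all: "L t < L s" if "\<not> parabolic m A" "0 \<le> s" "s < t" for s t
    using that L_strict by (auto simp: parabolic_def min_norm)
  have hyp: "\<not> parabolic m A" if hyperbolic: "hyperbolic m A"
  proof
    assume par: "parabolic m A"
    obtain \<alpha> c where *: "\<alpha> > 1" "c > 0" "\<And>k. c * \<alpha> ^ k \<le> min_norm m A k"
      using hyperbolic by (auto simp: hyperbolic_def)
    have "c \<le> 0"
    proof (rule tendsto_lowerbound)
      show "(\<lambda>k. min_norm m A k / \<alpha> ^ k) \<longlonglongrightarrow> 0" using par * by (auto simp: parabolic_def)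
      show "\<forall>\<^sub>F k in sequentially. c \<le> min_norm m A k / \<alpha> ^ k"
        using * by (auto simp: pos_le_divide_eq)
    qed simp
    with * show False by simp
  qed
  \<comment> \<open>Convergence beyond \<open>s\<^sub>A\<close> gives \<open>L s \<le> 0\<close>,
    and subexponential minimal norms give \<open>L s \<ge> 0\<close>.\<close>
  have par: "L s = 0" if "parabolic m A" "s > s\<^sub>A" for s
    using L_nonneg[of s] L_above[of s] that \<open>s\<^sub>A > 0\<close> by (auto simp: parabolic_def min_norm)
  have "convex_on {0..} (\<lambda>s. ln (xi m A s))"
    using L_convex by (simp add: convex_on_def xi)
  moreover have "antimono_on {0..} (xi m A)"
    by (rule monotone_onI) (auto simp: xi L_antimono)
  moreover have "strict_antimono_on {0..s\<^sub>A} (xi m A)"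
    by (rule monotone_onI) (auto simp: xi strict)
  moreover have "strict_antimono_on {0..} (xi m A)" if "\<not> parabolic m A"
    by (rule monotone_onI) (use strict_all[OF that] in \<open>auto simp: xi\<close>)
  moreover have "xi m A s < 1" if "hyperbolic m A" "s > s\<^sub>A" for s
    using strict_all[OF hyp, of "s\<^sub>A" s] that \<open>s\<^sub>A > 0\<close> by (simp add: xi L_eq)
  ultimately show ?thesis
    using xi_lim L_below par assms(1) \<open>s\<^sub>A > 0\<close>
    by (auto simp: xi L_0 L_eq convergent_def)
qed

end
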